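(* Let $a\ge 2$ be an integer, let $\alpha:=\log(a/(a-1))$, and let $N_q$ ($q=1,2,\ldots$) be as in the context. There do not exist real sequences $(c_q)_{q\ge1}$ with $c_q>0$ and $(d_q)_{q\ge1}$ such that $(N_q-d_q)/c_q$ has a non-degenerate limit distribution as $q\to\infty$. However, with $b_q:=\alpha^{-1}\log(aq)$, for all $x\in\mathbb{R}$ $$\Lambda(\alpha(x-1))=\liminf_{q\to\infty}P(N_q-b_q\le x)\le\limsup_{q\to\infty}P(N_q-b_q\le x)=\Lambda(\alpha x)$$ (that is, $N_q-b_q$ is, in distribution, asymptotically between $\alpha^{-1}Z$ and $1+\alpha^{-1}Z$, where $Z$ has the Gumbel distribution, and these distributional bounds are sharp). Moreover, for each integer $n$, $$P(N_q-\lceil b_q\rceil=n)-\Lambda\bigl(\alpha(n+1-\{b_q\})\bigr)+\Lambda\bigl(\alpha(n-\{b_q\})\bigr)\to0\quad\text{as }q\to\infty,$$ where $\{x\}:=x-\lfloor x\rfloor$ and, by convention here, $\lceil x\rceil:=\lfloor x\rfloor+1$ for every real $x$.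
   Context: Coupon collecting: fix an integer $a\ge2$. Let $Y$ be the number of independent uniform draws (with replacement) from a set of $a$ types needed until every one of the $a$ types has been drawn at least once. For $q\in\{1,2,\ldots\}$, $N_q:=\max\{Y_1,\ldots,Y_q\}$, where $Y_1,\ldots,Y_q$ are independent random variables each distributed as $Y$. (Equivalently, a test has $q$ questions, each chosen independently and uniformly from its own separate bank of $a$ alternatives; $N_q$ is the number of independently generated tests needed to see all $aq$ questions at least once.) The integer $a$ is fixed while $q\to\infty$. The Gumbel distribution has distribution function $\Lambda(x)=\exp(-e^{-x})$, $x\in\mathbb{R}$. $\lfloor x\rfloor$ is the integer part (floor) of $x$. "Has a non-degenerate limit distribution" means convergence in distribution to a (finite-valued) random variable that is not almost surely constant. *)

theory Defs
  imports "HOL-Probability.Probability"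
begin

text \<open>
  The types are \<open>{..<a}\<close> and a run of draws is an infinite stream. If some type never appears
  (a null event), the value of \<open>LEAST\<close> is an unspecified natural number.
\<close>

definition coupon_time :: "nat \<Rightarrow> nat stream \<Rightarrow> nat" where
  "coupon_time a \<omega> = (LEAST n. {..<a} \<subseteq> set (stake n \<omega>))"

text \<open>The law of \<open>Y\<close>: the draws are independent and uniform on \<open>{..<a}\<close>.\<close>

definition coupon_law :: "nat \<Rightarrow> nat measure" where
  "coupon_law a =
     distr (stream_space (measure_pmf (pmf_of_set {..<a}))) (count_space UNIV) (coupon_time a)"

definition gumbel_cdf :: "real \<Rightarrow> real" where
  "gumbel_cdf x = exp (- exp (- x))"

text \<open>
  The variables may live on different spaces. Since \<open>real_distribution \<nu>\<close> makes \<open>\<nu>\<close> a probability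
  measure on the reals, the limit is finite-valued and no mass escapes to infinity.
\<close>

definition has_nondegenerate_limit :: "(nat \<Rightarrow> 'w measure) \<Rightarrow> (nat \<Rightarrow> 'w \<Rightarrow> real) \<Rightarrow> bool" where
  "has_nondegenerate_limit M X \<longleftrightarrow>
     (\<exists>\<nu>. real_distribution \<nu> \<and> \<not> (\<exists>k. AE x in \<nu>. x = k) \<and>
          weak_conv_m (\<lambda>q. distr (M q) borel (X q)) \<nu>)"

lemma measurable_coupon_time:
  "coupon_time a \<in> stream_space (measure_pmf (pmf_of_set {..<a})) \<rightarrow>\<^sub>M count_space UNIV"
proof -
  have "coupon_time a = (\<lambda>\<omega>. LEAST n. \<forall>k\<in>{..<a}. \<exists>i\<in>{..<n}. \<omega> !! i = k)"
  proof (rule ext)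
    fix \<omega> :: "nat stream"
    have "set (stake n \<omega>) = (\<lambda>i. \<omega> !! i) ` {..<n}" for n
      by (force simp: set_conv_nth)
    then show "coupon_time a \<omega> = (LEAST n. \<forall>k\<in>{..<a}. \<exists>i\<in>{..<n}. \<omega> !! i = k)"
      by (simp add: coupon_time_def subset_eq image_iff eq_commute)
  qed
  also have "\<dots> \<in> stream_space (measure_pmf (pmf_of_set {..<a})) \<rightarrow>\<^sub>M count_space UNIV"
    by measurable
  finally show ?thesis .
qed

end

theory Submission
  imports Defs "HOL-Real_Asymp.Real_Asymp"
begin

text \<open>
  Put \<open>r = (a - 1) / a = exp (- \<alpha>)\<close> and \<open>u = a * r ^ n\<close>. By Bonferroni's inequalities
  \<open>P (Y > n)\<close> lies between \<open>u - u\<^sup>2\<close> and \<open>u\<close>, so \<open>P (N\<^sub>q \<le> n) = P (Y \<le> n) ^ q\<close> is within \<open>o(1)\<close> of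
  \<open>exp (- q * u) = \<Lambda> (\<alpha> * (n - b\<^sub>q))\<close>, uniformly over all integers \<open>n\<close>. The local limit is a difference
  of two such values. Since \<open>b\<^sub>q\<close> tends to infinity with increments tending to 0, its fractional
  part comes arbitrarily close to every point of the unit interval, which gives the lower and upper limits. Finally, if
  \<open>(N\<^sub>q - d\<^sub>q) / c\<^sub>q\<close> had a non-degenerate limit, then at a continuity point \<open>x\<close> where the limiting
  distribution function lies strictly between 0 and 1, inverting \<open>\<Lambda>\<close> would make
  \<open>\<lfloor>d\<^sub>q + c\<^sub>q * x\<rfloor> - b\<^sub>q\<close> converge; so the integers \<open>\<lfloor>d\<^sub>q + c\<^sub>q * x\<rfloor>\<close> would eventually be
  constant and \<open>b\<^sub>q\<close> bounded.
\<close>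

section \<open>Comparing powers of 1 - v with exponentials\<close>

lemma square_times_exp_le:
  fixes x :: real
  assumes "x \<ge> 0"
  shows "x\<^sup>2 * exp (- (x / 2)) \<le> 16"
proof -
  \<comment> \<open>Squaring this bound produces \<open>exp (x / 2)\<close>, and the factor 4 in the
    denominator becomes the constant 16.\<close>
  have "x / 4 \<le> exp (x / 4)"
    using exp_ge_add_one_self[of "x / 4"] by linarith
  then have "(x / 4)\<^sup>2 \<le> (exp (x / 4))\<^sup>2"
    using assms by (intro power_mono) auto
  also have "\<dots> = exp (x / 2)"
    by (simp add: exp_double[symmetric])
  finally have "x\<^sup>2 \<le> 16 * exp (x / 2)"
    by (simp add: power_divide)
  then show ?thesis
    by (simp add: exp_minus divide_inverse[symmetric] divide_le_eq)
qed

text \<open>Taking logarithms, the power and the exponential differ by a factor whose exponent is of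
  order q times \<open>u\<^sup>2\<close>. With x = q u this is \<open>x\<^sup>2 / q\<close>, and the
  decay in x absorbs \<open>x\<^sup>2\<close>, so the bound does not involve u. The constant is 2 *
  16, the 2 coming from the lower bound -u - 2 \<open>u\<^sup>2\<close> for ln (1 - u), valid for u
  \<le> 1/2.\<close>

lemma power_one_minus_approx_exp:
  fixes u v :: real
  assumes q: "q \<ge> 1" and u: "0 \<le> u" "u \<le> 1/2" and v: "u - u\<^sup>2 \<le> v" "v \<le> u"
  shows "\<bar>(1 - v) ^ q - exp (- (real q * u))\<bar> \<le> 32 / real q"
proof -
  define x where "x = real q * u"
  have x0: "x \<ge> 0" using u by (simp add: x_def)
  have qu2: "real q * u\<^sup>2 = x\<^sup>2 / real q"
    using q by (simp add: x_def power2_eq_square)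
  \<comment> \<open>The restriction u \<le> 1/2 ensures that the correction
    \<open>exp (x\<^sup>2 / q)\<close> uses up at most half of the decay exp (-x), leaving exp (-x /
    2).\<close>
  have uu: "u\<^sup>2 \<le> u / 2"
    using u mult_left_mono[of u "1/2" u] by (simp add: power2_eq_square)
  have x2: "x\<^sup>2 / real q \<le> x / 2"
    using mult_left_mono[OF uu, of "real q"] unfolding qu2[symmetric] by (simp add: x_def)
  have main: "x\<^sup>2 / real q * exp (- (x / 2)) \<le> 16 / real q"
    using divide_right_mono[OF square_times_exp_le[OF x0], of "real q"] by (simp add: field_simps)
  have "1 - v \<le> exp (- u + u\<^sup>2)"
    using v exp_ge_add_one_self[of "- u + u\<^sup>2"] by linarith
  then have "(1 - v) ^ q \<le> exp (- u + u\<^sup>2) ^ q"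
    using u v by (intro power_mono) auto
  also have "\<dots> = exp (- x + x\<^sup>2 / real q)"
    using qu2 by (simp add: exp_of_nat_mult[symmetric] x_def algebra_simps)
  finally have "(1 - v) ^ q - exp (- x) \<le> exp (- x + x\<^sup>2 / real q) * (1 - exp (- (x\<^sup>2 / real q)))"
    by (simp add: algebra_simps exp_add[symmetric])
  also have "\<dots> \<le> exp (- (x / 2)) * (x\<^sup>2 / real q)"
  proof (intro mult_mono)
    show "exp (- x + x\<^sup>2 / real q) \<le> exp (- (x / 2))"
      unfolding exp_le_cancel_iff using x2 by linarith
    show "1 - exp (- (x\<^sup>2 / real q)) \<le> x\<^sup>2 / real q"
      using exp_ge_add_one_self[of "- (x\<^sup>2 / real q)"] by linarith
  qed auto
  finally have upper: "(1 - v) ^ q - exp (- x) \<le> 16 / real q"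
    using main by (simp add: mult.commute)
  have "exp (- u - 2 * u\<^sup>2) \<le> exp (ln (1 - u))"
    using ln_one_minus_pos_lower_bound[OF u] by simp
  also have "\<dots> \<le> 1 - v"
    using u v by simp
  finally have "exp (- u - 2 * u\<^sup>2) ^ q \<le> (1 - v) ^ q"
    by (intro power_mono) auto
  moreover have "exp (- u - 2 * u\<^sup>2) ^ q = exp (- x - 2 * (x\<^sup>2 / real q))"
    using qu2 by (simp add: exp_of_nat_mult[symmetric] x_def algebra_simps)
  ultimately have "exp (- x) - (1 - v) ^ q \<le> exp (- x) * (1 - exp (- (2 * (x\<^sup>2 / real q))))"
    by (simp add: algebra_simps exp_add[symmetric])
  also have "\<dots> \<le> exp (- (x / 2)) * (2 * (x\<^sup>2 / real q))"
  proof (intro mult_mono)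
    show "1 - exp (- (2 * (x\<^sup>2 / real q))) \<le> 2 * (x\<^sup>2 / real q)"
      using exp_ge_add_one_self[of "- (2 * (x\<^sup>2 / real q))"] by linarith
  qed (use x0 in auto)
  finally have lower: "exp (- x) - (1 - v) ^ q \<le> 32 / real q"
    using main by argo
  have "16 / real q \<le> 32 / real q" by (simp add: divide_right_mono)
  with upper lower show ?thesis
    by (simp add: abs_le_iff x_def)
qed

section \<open>Tail bounds for the collecting time of a single coupon set\<close>

lemma prob_stake_subset:
  fixes p :: "'a :: countable pmf"
  shows "measure (stream_space (measure_pmf p)) {\<omega>. set (stake n \<omega>) \<subseteq> S} = measure_pmf.prob p S ^ n"
proof -
  let ?A = "\<lambda>n. {\<omega>. set (stake n \<omega>) \<subseteq> S}"
  have sp: "space (stream_space (measure_pmf p)) = UNIV"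
    by (simp add: space_stream_space)
  have eq: "?A n = {\<omega> \<in> space (stream_space (measure_pmf p)). \<forall>i\<in>{..<n}. \<omega> !! i \<in> S}" for n
    unfolding sp by (force simp: set_conv_nth)
  have A [measurable]: "?A n \<in> sets (stream_space (measure_pmf p))" for n
    unfolding eq by measurable
  interpret S: prob_space "stream_space (measure_pmf p)"
    by (intro prob_space.prob_space_stream_space prob_space_measure_pmf)
  have "emeasure (stream_space (measure_pmf p)) (?A n) = emeasure (measure_pmf p) S ^ n"
  proof (induction n)
    case 0
    then show ?case using S.emeasure_space_1 by (simp add: sp)
  next
    case (Suc n)
    have [simp]: "{\<omega>. shd \<omega> \<in> S \<and> set (stake n (stl \<omega>)) \<subseteq> S} \<in> S.events"
      using A[of "Suc n"] by simp
    \<comment> \<open>Conditioning on the first draw: the rest of the stream has the original law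
      again, so each draw contributes one factor.\<close>
    have "emeasure (stream_space (measure_pmf p)) (?A (Suc n)) =
        (\<integral>\<^sup>+t. emeasure (stream_space (measure_pmf p)) (?A n) * indicator S t \<partial>measure_pmf p)"
      by (subst prob_space.emeasure_stream_space[OF prob_space_measure_pmf])
         (auto simp: sp intro!: nn_integral_cong split: split_indicator)
    also have "\<dots> = emeasure (measure_pmf p) S ^ Suc n"
      by (subst nn_integral_cmult_indicator) (auto simp: Suc.IH mult.commute)
    finally show ?case .
  qed
  then show ?thesis
    by (simp add: S.emeasure_eq_measure measure_pmf.emeasure_eq_measure ennreal_power)
qed

text \<open>A coarse second Bonferroni inequality: adjoining the set of index k loses at most its
  overlaps with the k earlier sets, hence k s. Counting \<open>k\<^sup>2\<close> instead of k (k -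
  1) / 2 pairs suffices, since the pair term then becomes at most \<open>u\<^sup>2\<close> for u = a
  \<open>r ^ n\<close>.\<close>

lemma (in finite_measure) measure_UN_lessThan_ge:
  assumes A: "\<And>i. i < k \<Longrightarrow> A i \<in> sets M"
    and r: "\<And>i. i < k \<Longrightarrow> measure M (A i) \<ge> r"
    and s: "\<And>i j. i < j \<Longrightarrow> j < k \<Longrightarrow> measure M (A i \<inter> A j) \<le> s"
    and "s \<ge> 0"
  shows "measure M (\<Union>i<k. A i) \<ge> real k * r - (real k)\<^sup>2 * s"
  using A r s
proof (induction k)
  case 0
  then show ?case by simp
next
  case (Suc k)
  have IH: "real k * r - (real k)\<^sup>2 * s \<le> measure M (\<Union>i<k. A i)"
    using Suc.prems by (intro Suc.IH) auto
  have U: "(\<Union>i<k. A i) \<in> sets M" using Suc.prems(1) by auto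
  have "measure M ((\<Union>i<k. A i) \<inter> A k) = measure M (\<Union>i<k. A i \<inter> A k)"
    by (rule arg_cong[where f = "measure M"]) auto
  also have "\<dots> \<le> (\<Sum>i<k. measure M (A i \<inter> A k))"
    using Suc.prems(1) by (intro finite_measure_subadditive_finite) auto
  also have "\<dots> \<le> (\<Sum>i<k. s)"
    using Suc.prems(3) by (intro sum_mono) auto
  finally have I: "measure M ((\<Union>i<k. A i) \<inter> A k) \<le> real k * s" by simp
  have "measure M (\<Union>i<Suc k. A i) = measure M ((\<Union>i<k. A i) \<union> A k)"
    by (simp add: lessThan_Suc Un_commute)
  also have "\<dots> = measure M (\<Union>i<k. A i) + measure M (A k) - measure M ((\<Union>i<k. A i) \<inter> A k)"
    using U Suc.prems(1) by (intro measure_Un3) (auto simp: fmeasurable_eq_sets)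
  also have "\<dots> \<ge> (real k * r - (real k)\<^sup>2 * s) + r - real k * s"
    using IH I Suc.prems(2)[of k] by linarith
  finally have "measure M (\<Union>i<Suc k. A i) \<ge> real (Suc k) * r - ((real k)\<^sup>2 + real k) * s"
    by (simp add: algebra_simps)
  moreover have "((real k)\<^sup>2 + real k) * s \<le> (real (Suc k))\<^sup>2 * s"
    using \<open>s \<ge> 0\<close> by (intro mult_right_mono) (auto simp: power2_eq_square algebra_simps)
  ultimately show ?case by linarith
qed

text \<open>The assumption makes the \<open>LEAST\<close> an attained minimum; on a stream that
  misses a type its value is unspecified. The rest is monotonicity of the set of seen types.\<close>

lemma coupon_time_le_iff:
  assumes "{..<a} \<subseteq> set (stake m \<omega>)"
  shows "coupon_time a \<omega> \<le> n \<longleftrightarrow> {..<a} \<subseteq> set (stake n \<omega>)"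
proof
  assume "coupon_time a \<omega> \<le> n"
  then have "set (stake (coupon_time a \<omega>) \<omega>) \<subseteq> set (stake n \<omega>)"
    by (metis le_Suc_ex set_append stake_add Un_upper1)
  moreover have "{..<a} \<subseteq> set (stake (coupon_time a \<omega>) \<omega>)"
    unfolding coupon_time_def using assms by (rule LeastI[where P = "\<lambda>n. {..<a} \<subseteq> set (stake n \<omega>)"])
  ultimately show "{..<a} \<subseteq> set (stake n \<omega>)"
    by simp
next
  assume "{..<a} \<subseteq> set (stake n \<omega>)"
  then show "coupon_time a \<omega> \<le> n"
    unfolding coupon_time_def by (rule Least_le)
qed

context
  fixes a :: nat and P :: "nat stream measure"
  assumes a: "a \<ge> 2"
  defines "P \<equiv> stream_space (measure_pmf (pmf_of_set {..<a}))"
begin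

interpretation P: prob_space P
  unfolding P_def by (intro prob_space.prob_space_stream_space prob_space_measure_pmf)

lemma space_coupon_stream: "space P = UNIV"
  by (simp add: P_def space_stream_space)

lemma measurable_stake_mem [measurable]: "{\<omega>. k \<in> set (stake n \<omega>)} \<in> sets P"
proof -
  have "{\<omega>. k \<in> set (stake n \<omega>)} = {\<omega> \<in> space P. \<exists>i\<in>{..<n}. \<omega> !! i = k}"
    unfolding space_coupon_stream by (force simp: set_conv_nth)
  also have "\<dots> \<in> sets P"
    unfolding P_def by measurable
  finally show ?thesis .
qed

lemma measurable_stake_notmem [measurable]: "{\<omega>. k \<notin> set (stake n \<omega>)} \<in> sets P"
  using sets.compl_sets[OF measurable_stake_mem[of k n]] by (simp add: space_coupon_stream Collect_neg_eq Compl_eq_Diff_UNIV)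

text \<open>Singletons and pairs \<open>K\<close> give the first and second order terms of
  Bonferroni's inequalities.\<close>

lemma prob_avoid_types:
  assumes "K \<subseteq> {..<a}"
  shows "measure P {\<omega>. set (stake n \<omega>) \<inter> K = {}} = ((real a - real (card K)) / real a) ^ n"
proof -
  have "{\<omega>. set (stake n \<omega>) \<inter> K = {}} = {\<omega>. set (stake n \<omega>) \<subseteq> - K}" by auto
  moreover have "measure_pmf.prob (pmf_of_set {..<a}) (- K) = (real a - real (card K)) / real a"
  proof -
    have ne: "{..<a} \<noteq> {}" using a by (auto simp: lessThan_empty_iff)
    have "card ({..<a} - K) = a - card K"
      using assms by (subst card_Diff_subset) (auto intro: finite_subset)
    moreover have "card K \<le> a" using card_mono[OF _ assms] by simp
    moreover have "{..<a} \<inter> - K = {..<a} - K" by auto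
    ultimately show ?thesis using ne by (simp add: measure_pmf_of_set of_nat_diff)
  qed
  ultimately show ?thesis
    unfolding P_def by (simp add: prob_stake_subset)
qed

lemma incomplete_eq: "{\<omega>. \<not> {..<a} \<subseteq> set (stake n \<omega>)} = (\<Union>i<a. {\<omega>. i \<notin> set (stake n \<omega>)})"
  by auto

lemma prob_missing_type: "i < a \<Longrightarrow> measure P {\<omega>. i \<notin> set (stake n \<omega>)} = ((real a - 1) / real a) ^ n"
  using prob_avoid_types[of "{i}" n] by simp

lemma prob_incomplete_le:
  "measure P {\<omega>. \<not> {..<a} \<subseteq> set (stake n \<omega>)} \<le> real a * ((real a - 1) / real a) ^ n"
proof -
  have "measure P (\<Union>i<a. {\<omega>. i \<notin> set (stake n \<omega>)}) \<le> (\<Sum>i<a. measure P {\<omega>. i \<notin> set (stake n \<omega>)})"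
    by (intro P.finite_measure_subadditive_finite) auto
  then show ?thesis by (simp add: prob_missing_type incomplete_eq)
qed

lemma prob_incomplete_ge:
  "measure P {\<omega>. \<not> {..<a} \<subseteq> set (stake n \<omega>)} \<ge>
     real a * ((real a - 1) / real a) ^ n - (real a * ((real a - 1) / real a) ^ n)\<^sup>2"
proof -
  let ?A = "\<lambda>i. {\<omega>. i \<notin> set (stake n \<omega>)}" and ?s = "((real a - 2) / real a) ^ n"
  have "measure P (?A i \<inter> ?A j) \<le> ?s" if "i < j" "j < a" for i j
  proof -
    have "?A i \<inter> ?A j = {\<omega>. set (stake n \<omega>) \<inter> {i, j} = {}}" by auto
    then show ?thesis using prob_avoid_types[of "{i, j}" n] that by simp
  qed
  then have "measure P (\<Union>i<a. ?A i) \<ge> real a * ((real a - 1) / real a) ^ n - (real a)\<^sup>2 * ?s"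
    using a by (intro P.measure_UN_lessThan_ge) (auto simp: prob_missing_type)
  \<comment> \<open>Since a (a - 2) \<le> \<open>(a - 1)\<^sup>2\<close>, missing two given types is
    at most as likely as if the two events were independent.\<close>
  moreover have "?s \<le> (((real a - 1) / real a)\<^sup>2) ^ n"
    using a by (intro power_mono) (auto simp: field_simps power2_eq_square)
  then have "(real a)\<^sup>2 * ?s \<le> (real a * ((real a - 1) / real a) ^ n)\<^sup>2"
    by (simp add: power_mult_distrib power_mult[symmetric] mult.commute mult_left_mono)
  ultimately show ?thesis by (simp add: incomplete_eq)
qed

text \<open>Serves the range of small n, where u = a \<open>r ^ n\<close> is not small and u -
  \<open>u\<^sup>2\<close> may be negative: a single missing type still gives the lower bound u /
  a.\<close>

lemma prob_incomplete_ge_missing: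
  "measure P {\<omega>. \<not> {..<a} \<subseteq> set (stake n \<omega>)} \<ge> ((real a - 1) / real a) ^ n"
proof -
  have "measure P {\<omega>. 0 \<notin> set (stake n \<omega>)} \<le> measure P (\<Union>i<a. {\<omega>. i \<notin> set (stake n \<omega>)})"
    using a by (intro P.finite_measure_mono UN_upper) auto
  then show ?thesis using a by (simp add: prob_missing_type incomplete_eq)
qed

text \<open>A stream that never completes the set is incomplete after every n draws, which has
  probability at most a \<open>r ^ n\<close>, tending to 0. This discards the streams on which
  \<open>coupon_time\<close> is unspecified.\<close>

lemma AE_coupon_complete: "AE \<omega> in P. \<exists>m. {..<a} \<subseteq> set (stake m \<omega>)"
proof (rule AE_I)
  let ?r = "(real a - 1) / real a"
  show "{\<omega> \<in> space P. \<not> (\<exists>m. {..<a} \<subseteq> set (stake m \<omega>))} \<subseteq> (\<Inter>m. (\<Union>i<a. {\<omega>. i \<notin> set (stake m \<omega>)}))"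
    by auto
  show m: "(\<Inter>m. (\<Union>i<a. {\<omega>. i \<notin> set (stake m \<omega>)})) \<in> sets P"
    by measurable
  have "(\<lambda>n. real a * ?r ^ n) \<longlonglongrightarrow> real a * 0"
    using a by (intro tendsto_mult tendsto_const LIMSEQ_realpow_zero) auto
  moreover have "measure P (\<Inter>m. (\<Union>i<a. {\<omega>. i \<notin> set (stake m \<omega>)})) \<le> real a * ?r ^ n" for n
    using P.finite_measure_mono[of "\<Inter>m. (\<Union>i<a. {\<omega>. i \<notin> set (stake m \<omega>)})" "\<Union>i<a. {\<omega>. i \<notin> set (stake n \<omega>)}"]
      prob_incomplete_le[of n] by (force simp: incomplete_eq)
  ultimately have "measure P (\<Inter>m. (\<Union>i<a. {\<omega>. i \<notin> set (stake m \<omega>)})) \<le> real a * 0"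
    by (intro LIMSEQ_le_const) auto
  then show "emeasure P (\<Inter>m. (\<Union>i<a. {\<omega>. i \<notin> set (stake m \<omega>)})) = 0"
    by (simp add: P.emeasure_eq_measure measure_le_0_iff)
qed

lemma measure_coupon_law_atMost:
  "measure (coupon_law a) {..n} = 1 - measure P {\<omega>. \<not> {..<a} \<subseteq> set (stake n \<omega>)}"
proof -
  have [measurable]: "coupon_time a \<in> P \<rightarrow>\<^sub>M count_space UNIV"
    unfolding P_def by (rule measurable_coupon_time)
  have B: "{\<omega>. \<not> {..<a} \<subseteq> set (stake n \<omega>)} \<in> sets P"
    unfolding incomplete_eq by measurable
  have "measure (coupon_law a) {..n} = measure P {\<omega> \<in> space P. coupon_time a \<omega> \<le> n}"
    unfolding coupon_law_def P_def[symmetric]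
    by (subst measure_distr) (auto intro!: arg_cong[where f = "measure P"])
  also have "\<dots> = measure P (space P - {\<omega>. \<not> {..<a} \<subseteq> set (stake n \<omega>)})"
  proof (rule P.finite_measure_eq_AE)
    \<comment> \<open>Equality of the events holds only almost surely: on a stream missing some
      type, the unspecified value of \<open>coupon_time\<close> may happen to be at most n.\<close>
    show "AE x in P. x \<in> {\<omega> \<in> space P. coupon_time a \<omega> \<le> n} \<longleftrightarrow>
        x \<in> space P - {\<omega>. \<not> {..<a} \<subseteq> set (stake n \<omega>)}"
      using AE_coupon_complete by eventually_elim (auto simp: coupon_time_le_iff)
  qed (use B in measurable)
  also have "\<dots> = 1 - measure P {\<omega>. \<not> {..<a} \<subseteq> set (stake n \<omega>)}"
    by (rule P.prob_compl[OF B])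
  finally show ?thesis .
qed

end

lemma coupon_law_tail_bounds:
  assumes "a \<ge> 2"
  defines "u \<equiv> \<lambda>n. real a * ((real a - 1) / real a) ^ n"
  shows "1 - measure (coupon_law a) {..n} \<le> u n"
    and "1 - measure (coupon_law a) {..n} \<ge> u n - (u n)\<^sup>2"
    and "1 - measure (coupon_law a) {..n} \<ge> u n / real a"
  using prob_incomplete_le[OF assms(1), of n] prob_incomplete_ge[OF assms(1), of n]
    prob_incomplete_ge_missing[OF assms(1), of n] assms(1)
  by (simp_all add: measure_coupon_law_atMost u_def)

section \<open>The maximum of q independent collecting times and its Gumbel approximation\<close>

lemma (in prob_space) prob_Max_le_eq_power:
  fixes Y :: "nat \<Rightarrow> 'a \<Rightarrow> nat"
  assumes q: "q \<ge> 1"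
    and indep: "indep_vars (\<lambda>_. count_space UNIV) Y {1..q}"
    and distr: "\<And>j. j \<in> {1..q} \<Longrightarrow> distr M (count_space UNIV) (Y j) = D"
  shows "prob {\<omega> \<in> space M. Max ((\<lambda>j. Y j \<omega>) ` {1..q}) \<le> k} = measure D {..k} ^ q"
proof -
  have "{\<omega> \<in> space M. Max ((\<lambda>j. Y j \<omega>) ` {1..q}) \<le> k} = (\<Inter>j\<in>{1..q}. Y j -` {..k} \<inter> space M)"
    using q by (auto simp: Max_le_iff)
  then have "prob {\<omega> \<in> space M. Max ((\<lambda>j. Y j \<omega>) ` {1..q}) \<le> k}
      = (\<Prod>j\<in>{1..q}. prob (Y j -` {..k} \<inter> space M))"
    using indep_varsD_finite[OF indep] q by simp
  also have "\<dots> = (\<Prod>j\<in>{1..q}. measure D {..k})"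
  proof (rule prod.cong)
    fix j assume j: "j \<in> {1..q}"
    then have "Y j \<in> M \<rightarrow>\<^sub>M count_space UNIV"
      using indep by (auto simp: indep_vars_def)
    then show "prob (Y j -` {..k} \<inter> space M) = measure D {..k}"
      by (simp add: distr[OF j, symmetric] measure_distr)
  qed simp
  finally show ?thesis by simp
qed

text \<open>The error bound is free of n. For u \<le> 1/2 the error is at most 32 / q. For u > 1/2
  both quantities are tiny: the Gumbel value is at most exp (-q / 2) and the probability at most exp
  (-q / (2 a)).\<close>

lemma gumbel_approx:
  fixes Y :: "nat \<Rightarrow> 'w \<Rightarrow> nat" and n :: int
  assumes a: "a \<ge> 2" and q: "q \<ge> 1"
    and "prob_space M"
    and indep: "prob_space.indep_vars M (\<lambda>_. count_space UNIV) Y {1..q}"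
    and distr: "\<And>j. j \<in> {1..q} \<Longrightarrow> distr M (count_space UNIV) (Y j) = coupon_law a"
  defines "\<alpha> \<equiv> ln (real a / (real a - 1))"
  shows "\<bar>measure M {\<omega> \<in> space M. int (Max ((\<lambda>j. Y j \<omega>) ` {1..q})) \<le> n}
           - gumbel_cdf (\<alpha> * (of_int n - inverse \<alpha> * ln (real a * real q)))\<bar>
         \<le> 32 / real q + exp (- (real q / 2)) + exp (- (real q / (2 * real a)))"
    (is "\<bar>?F - ?G\<bar> \<le> _")
proof -
  interpret prob_space M by fact
  \<comment> \<open>The exponential form of a \<open>r ^ n\<close> makes sense for negative n as
    well.\<close>
  define u where "u = real a * exp (- (\<alpha> * of_int n))"
  have \<alpha>: "\<alpha> > 0" using a by (simp add: \<alpha>_def)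
  have r: "exp (- \<alpha>) = (real a - 1) / real a"
    using a by (simp add: \<alpha>_def exp_minus)
  \<comment> \<open>The centring is chosen so that its contribution is exactly the factor a q, which
    turns the inner exponential of the Gumbel function into q u.\<close>
  have "exp (- (\<alpha> * (of_int n - inverse \<alpha> * ln (real a * real q)))) = exp (- (\<alpha> * of_int n) + ln (real a * real q))"
    using \<alpha> by (simp add: algebra_simps)
  also have "\<dots> = real q * u"
    using a q by (simp add: exp_diff exp_minus field_simps u_def)
  finally have G: "?G = exp (- (real q * u))"
    by (simp add: gumbel_cdf_def)
  have u0: "u \<ge> 0" by (simp add: u_def)
  have G0: "0 \<le> ?G" by (simp add: gumbel_cdf_def)
  have G1: "?G \<le> exp (- (real q / 2))" if "u > 1/2"
    using that q unfolding G by (simp add: field_simps)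
  show ?thesis
  proof (cases "n \<ge> 0")
    \<comment> \<open>For negative n the probability vanishes, and u \<ge> a \<ge> 2 puts the Gumbel
      value in the negligible range.\<close>
    case False
    then have "?F = 0"
      by (intro measure_eq_0_null_sets) auto
    moreover have "exp 0 \<le> exp (- (\<alpha> * of_int n))"
      using False \<alpha> by (subst exp_le_cancel_iff) (simp add: mult_le_0_iff)
    then have "u > 1/2"
      using a mult_mono[of 2 "real a" 1 "exp (- (\<alpha> * of_int n))"] by (simp add: u_def)
    ultimately show ?thesis
      using G1 G0 q by (simp add: add_nonneg_nonneg add.commute add_increasing add_increasing2)
  next
    case True
    define v where "v = 1 - measure (coupon_law a) {..nat n}"
    have un: "u = real a * ((real a - 1) / real a) ^ nat n"
      using True by (simp add: u_def r[symmetric] exp_of_nat_mult[symmetric] mult.commute)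
    have v: "v \<le> u" "u - u\<^sup>2 \<le> v" "u / real a \<le> v"
      using coupon_law_tail_bounds[OF a, of "nat n"] by (simp_all add: v_def un)
    have "{\<omega> \<in> space M. int (Max ((\<lambda>j. Y j \<omega>) ` {1..q})) \<le> n} =
        {\<omega> \<in> space M. Max ((\<lambda>j. Y j \<omega>) ` {1..q}) \<le> nat n}"
      using True by (auto simp: nat_le_iff le_nat_iff)
    then have F: "?F = (1 - v) ^ q"
      using prob_Max_le_eq_power[OF q indep distr, of "nat n"] by (simp add: v_def)
    show ?thesis
    proof (cases "u \<le> 1/2")
      case True
      have "\<bar>?F - ?G\<bar> \<le> 32 / real q"
        unfolding F G using power_one_minus_approx_exp[OF q u0 True v(2,1)] .
      then show ?thesis
        using exp_gt_zero[of "- (real q / 2)"] exp_gt_zero[of "- (real q / (2 * real a))"] by linarith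
    next
      case False
      have "1 - v \<le> exp (- (u / real a))"
        using v(3) exp_ge_add_one_self[of "- (u / real a)"] by linarith
      then have "(1 - v) ^ q \<le> exp (- (u / real a)) ^ q"
        by (intro power_mono) (simp_all add: v_def)
      also have "\<dots> \<le> exp (- (real q / (2 * real a)))"
        using False a q by (simp add: exp_of_nat_mult[symmetric] field_simps)
      finally have "?F \<le> exp (- (real q / (2 * real a)))" unfolding F .
      moreover have "?F \<ge> 0" by simp
      moreover have "32 / real q \<ge> 0" by simp
      ultimately show ?thesis
        using G0 G1 False exp_gt_zero[of "- (real q / 2)"] by linarith
    qed
  qed
qed

section \<open>Fractional parts of a slowly diverging sequence; criteria for upper and lower
  limits\<close>

lemma frequently_frac_between:
  fixes y :: "nat \<Rightarrow> real"
  assumes y: "filterlim y at_top sequentially"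
    and inc: "(\<lambda>n. y (Suc n) - y n) \<longlonglongrightarrow> 0"
    and st: "0 \<le> s" "s < t" "t \<le> 1"
  shows "\<exists>\<^sub>F n in sequentially. s < frac (y n) \<and> frac (y n) < t"
  unfolding frequently_sequentially
proof
  fix Q0
  have "\<forall>\<^sub>F n in sequentially. \<bar>y (Suc n) - y n\<bar> < t - s"
    using order_tendstoD(2)[OF tendsto_rabs_zero[OF inc], of "t - s"] st by simp
  then obtain Q1 where Q1: "\<And>n. n \<ge> Q1 \<Longrightarrow> \<bar>y (Suc n) - y n\<bar> < t - s"
    unfolding eventually_sequentially by blast
  define Q where "Q = max Q0 Q1"
  have Q: "Q \<ge> Q0" "\<And>n. n \<ge> Q \<Longrightarrow> \<bar>y (Suc n) - y n\<bar> < t - s"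
    using Q1 by (auto simp: Q_def)
  \<comment> \<open>At index \<open>Q\<close> the sequence is still below m, hence below m + s. At
    the first later index n beyond m + s it has not passed m + t, because from \<open>Q\<close> on
    the increments are shorter than t - s. As t \<le> 1, the integer part there is m.\<close>
  define m where "m = \<lfloor>y Q\<rfloor> + 1"
  define n where "n = (LEAST n. n \<ge> Q \<and> y n > of_int m + s)"
  have "\<forall>\<^sub>F n in sequentially. n \<ge> Q \<and> y n > of_int m + s"
    using y by (intro eventually_conj eventually_ge_at_top) (auto simp: filterlim_at_top_dense)
  then have "\<exists>n. n \<ge> Q \<and> y n > of_int m + s"
    by (rule eventually_happens'[OF sequentially_bot])
  then have n: "n \<ge> Q \<and> y n > of_int m + s"
    unfolding n_def by (rule LeastI_ex)
  have "y Q < of_int m" unfolding m_def by linarith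
  then have "n \<noteq> Q" using n st by auto
  then obtain k where k: "n = Suc k" "k \<ge> Q"
    using n by (cases n) auto
  then have "y k \<le> of_int m + s"
    using not_less_Least[of k "\<lambda>n. n \<ge> Q \<and> y n > of_int m + s"] unfolding n_def[symmetric] by auto
  then have "y n < of_int m + t"
    using Q(2)[OF k(2)] k(1) by auto
  then have "\<lfloor>y n\<rfloor> = m"
    using n st by (intro floor_unique) auto
  then have "s < frac (y n) \<and> frac (y n) < t"
    using n \<open>y n < of_int m + t\<close> by (auto simp: frac_def)
  then show "\<exists>n\<ge>Q0. s < frac (y n) \<and> frac (y n) < t"
    using n Q(1) by (intro exI[of _ n]) simp
qed

lemma limsup_ereal_eqI:
  fixes f :: "nat \<Rightarrow> real"
  assumes upper: "\<And>e. e > 0 \<Longrightarrow> \<forall>\<^sub>F n in sequentially. f n \<le> C + e"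
    and lower: "\<And>e. e > 0 \<Longrightarrow> \<exists>\<^sub>F n in sequentially. f n \<ge> C - e"
  shows "limsup (\<lambda>n. ereal (f n)) = ereal C"
proof (rule antisym)
  show "limsup (\<lambda>n. ereal (f n)) \<le> ereal C"
  proof (rule ereal_le_epsilon2)
    fix e :: real assume "e > 0"
    then show "limsup (\<lambda>n. ereal (f n)) \<le> ereal C + ereal e"
      using upper by (intro Limsup_bounded) simp
  qed
  show "ereal C \<le> limsup (\<lambda>n. ereal (f n))"
  proof (rule ccontr)
    assume "\<not> ereal C \<le> limsup (\<lambda>n. ereal (f n))"
    then obtain z where z: "limsup (\<lambda>n. ereal (f n)) < ereal z" "ereal z < ereal C"
      using ereal_dense2[of "limsup (\<lambda>n. ereal (f n))" "ereal C"] by (auto simp: not_le)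
    then have "\<forall>\<^sub>F n in sequentially. ereal (f n) < ereal z"
      by (intro Limsup_lessD)
    moreover have "\<exists>\<^sub>F n in sequentially. f n \<ge> C - (C - z)"
      using z by (intro lower) simp
    ultimately show False
      by (simp add: frequently_def not_le)
  qed
qed

lemma liminf_ereal_eqI:
  fixes f :: "nat \<Rightarrow> real"
  assumes lower: "\<And>e. e > 0 \<Longrightarrow> \<forall>\<^sub>F n in sequentially. f n \<ge> C - e"
    and upper: "\<And>e. e > 0 \<Longrightarrow> \<exists>\<^sub>F n in sequentially. f n \<le> C + e"
  shows "liminf (\<lambda>n. ereal (f n)) = ereal C"
proof -
  have "limsup (\<lambda>n. ereal (- f n)) = ereal (- C)"
    using lower upper by (intro limsup_ereal_eqI) (simp_all add: algebra_simps)
  moreover have "limsup (\<lambda>n. ereal (- f n)) = - liminf (\<lambda>n. ereal (f n))"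
    using ereal_Limsup_uminus[of sequentially "\<lambda>n. ereal (f n)"] by simp
  ultimately have "- liminf (\<lambda>n. ereal (f n)) = - ereal C" by simp
  then show ?thesis by (simp only: ereal_uminus_eq_iff)
qed

section \<open>Non-degenerate limits, and limits governed by fractional parts\<close>

lemma isCont_gumbel_cdf: "isCont gumbel_cdf x"
  unfolding gumbel_cdf_def by (intro continuous_intros)

lemma gumbel_cdf_mono: "x \<le> y \<Longrightarrow> gumbel_cdf x \<le> gumbel_cdf y"
  by (simp add: gumbel_cdf_def)

text \<open>A distribution function with values 0 and 1 only has a single jump, at the infimum
  \<open>k\<close> of the points where it is 1, and so belongs to a point mass. Hence some value
  lies strictly between, and it remains to move to a continuity point.\<close>

lemma (in real_distribution) nondegenerate_continuity_point:
  assumes "\<not> (\<exists>k. AE x in M. x = k)"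
  obtains x where "isCont (cdf M) x" "0 < cdf M x" "cdf M x < 1"
proof -
  have "\<exists>x. 0 < cdf M x \<and> cdf M x < 1"
  proof (rule ccontr)
    assume "\<not> ?thesis"
    then have dich: "cdf M x = 0 \<or> cdf M x = 1" for x
      using cdf_nonneg[of x] cdf_bounded_prob[of x] by (metis less_eq_real_def)
    define S where "S = {x. cdf M x = 1}"
    define k where "k = Inf S"
    have "\<forall>\<^sub>F x in at_top. cdf M x > 0"
      using order_tendstoD(1)[OF cdf_lim_at_top_prob, of 0] by simp
    then obtain x1 where "cdf M x1 > 0"
      by (auto simp: eventually_at_top_linorder)
    then have ne: "S \<noteq> {}" using dich[of x1] by (auto simp: S_def)
    have "\<forall>\<^sub>F x in at_bot. cdf M x < 1"
      using order_tendstoD(2)[OF cdf_lim_at_bot, of 1] by simp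
    then obtain x0 where "cdf M x0 < 1"
      by (auto simp: eventually_at_bot_linorder)
    have bdd: "bdd_below S"
    proof (rule bdd_belowI)
      fix x assume "x \<in> S"
      then show "x0 \<le> x"
        using cdf_nondecreasing[of x x0] \<open>cdf M x0 < 1\<close> by (cases "x0 \<le> x") (auto simp: S_def)
    qed
    have gt: "cdf M x = 1" if less: "x > k" for x
    proof -
      obtain z where "z \<in> S" "z < x"
        using less cInf_lessD[OF ne] unfolding k_def by blast
      then show ?thesis
        using cdf_nondecreasing[of z x] cdf_bounded_prob[of x] by (simp add: S_def)
    qed
    have lt: "cdf M x = 0" if "x < k" for x
      using that cInf_lower[OF _ bdd, of x] dich[of x] unfolding k_def S_def by fastforce
    have "cdf M k = 1"
    proof (rule tendsto_unique[of "at_right k"])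
      show "(cdf M \<longlongrightarrow> cdf M k) (at_right k)"
        using cdf_is_right_cont[of k] by (simp add: continuous_within)
      show "(cdf M \<longlongrightarrow> 1) (at_right k)"
        by (rule tendsto_eventually) (auto simp: eventually_at_filter gt)
    qed simp
    moreover have "measure M {..<k} = 0"
    proof (rule tendsto_unique[OF _ cdf_at_left])
      show "(cdf M \<longlongrightarrow> 0) (at_left k)"
        by (rule tendsto_eventually) (auto simp: eventually_at_filter lt)
    qed simp
    moreover have "measure M {..k} = measure M {..<k} + measure M {k}"
      by (subst finite_measure_Union[symmetric]) (auto intro!: arg_cong[where f = prob])
    ultimately have "prob {k} = 1"
      by (simp add: cdf_def)
    then have "AE x in M. x = k"
      by (subst (asm) prob_eq_1) auto
    then show False using assms by blast
  qed
  then obtain x where x: "0 < cdf M x" "cdf M x < 1" by blast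
  have "(cdf M \<longlongrightarrow> cdf M x) (at_right x)"
    using cdf_is_right_cont[of x] by (simp add: continuous_within)
  from order_tendstoD(2)[OF this x(2)]
  obtain y where y: "y > x" "\<And>z. x < z \<Longrightarrow> z < y \<Longrightarrow> cdf M z < 1"
    by (auto simp: eventually_at_right[of x "x + 1"])
  \<comment> \<open>By right continuity the values stay below 1 on this interval. It is uncountable
    while the atoms are countable, so it contains a point that is not an atom.\<close>
  have "uncountable {x<..<y}" using y(1) by (simp add: uncountable_open_interval)
  then have "\<not> {x<..<y} \<subseteq> {x. measure M {x} > 0}"
    using countable_subset countable_atoms by blast
  then obtain z where z: "z \<in> {x<..<y}" "z \<notin> {x. measure M {x} > 0}"
    by blast
  show thesis
  proof
    show "isCont (cdf M) z"
      using z(2) by (simp add: isCont_cdf zero_less_measure_iff)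
    show "0 < cdf M z" "cdf M z < 1"
      using z(1) x y cdf_nondecreasing[of x z] by auto
  qed
qed

text \<open>Convergence would force the increments of the integers m to tend to 0, hence to vanish
  eventually, and a constant cannot follow b to infinity.\<close>

lemma int_diff_creeping_divergent:
  fixes b :: "nat \<Rightarrow> real" and m :: "nat \<Rightarrow> int"
  assumes b: "filterlim b at_top sequentially"
    and inc: "(\<lambda>n. b (Suc n) - b n) \<longlonglongrightarrow> 0"
  shows "\<not> (\<lambda>n. of_int (m n) - b n) \<longlonglongrightarrow> g"
proof
  assume g: "(\<lambda>n. of_int (m n) - b n) \<longlonglongrightarrow> g"
  have "(\<lambda>n. (of_int (m (Suc n)) - b (Suc n)) - (of_int (m n) - b n) + (b (Suc n) - b n)) \<longlonglongrightarrow> g - g + 0"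
    by (intro tendsto_intros g inc LIMSEQ_Suc[OF g])
  then have "(\<lambda>n. of_int (m (Suc n)) - of_int (m n) :: real) \<longlonglongrightarrow> 0" by simp
  then have "\<forall>\<^sub>F n in sequentially. \<bar>of_int (m (Suc n)) - of_int (m n) :: real\<bar> < 1"
    using order_tendstoD(2)[OF tendsto_rabs_zero, of _ sequentially 1] by simp
  then have "\<forall>\<^sub>F n in sequentially. m (Suc n) = m n"
    by eventually_elim linarith
  then obtain Q where Q: "\<And>n. n \<ge> Q \<Longrightarrow> m (Suc n) = m n"
    unfolding eventually_sequentially by blast
  have const: "m n = m Q" if "n \<ge> Q" for n
    using that by (induction n rule: dec_induct) (simp_all add: Q)
  have "\<forall>\<^sub>F n in sequentially. of_int (m n) - b n > g - 1"
    using order_tendstoD(1)[OF g, of "g - 1"] by simp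
  moreover have "\<forall>\<^sub>F n in sequentially. b n > of_int (m Q) - g + 1"
    using b by (auto simp: filterlim_at_top_dense)
  ultimately have "\<forall>\<^sub>F n in sequentially. False"
    using eventually_ge_at_top[of Q]
  proof eventually_elim
    case (elim n)
    then show False using const[of n] by simp
  qed
  then show False by simp
qed

text \<open>Since \<open>L\<close> is decreasing, its values on [0, 1) lie between
  \<open>L 1\<close> and \<open>L 0\<close>. Both ends are sharp because the fractional parts come
  arbitrarily close to 0 from the right and to 1 from the left; they never equal 1, so continuity of
  \<open>L\<close> there is what makes \<open>L 1\<close> the lower limit.\<close>

lemma limsup_liminf_via_frac:
  fixes y G :: "nat \<Rightarrow> real" and L :: "real \<Rightarrow> real"
  assumes y_top: "filterlim y at_top sequentially"
    and y_inc: "(\<lambda>q. y (Suc q) - y q) \<longlonglongrightarrow> 0"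
    and diff: "(\<lambda>q. G q - L (frac (y q))) \<longlonglongrightarrow> 0"
    and anti: "\<And>s t. s \<le> t \<Longrightarrow> L t \<le> L s"
    and contL: "\<And>t. isCont L t"
  shows "limsup (\<lambda>q. ereal (G q)) = ereal (L 0)"
    and "liminf (\<lambda>q. ereal (G q)) = ereal (L 1)"
proof -
  have close: "\<forall>\<^sub>F q in sequentially. \<bar>G q - L (frac (y q))\<bar> < e" if "e > 0" for e
    using order_tendstoD(2)[OF tendsto_rabs_zero[OF diff] that] .
  show "limsup (\<lambda>q. ereal (G q)) = ereal (L 0)"
  proof (rule limsup_ereal_eqI)
    fix e :: real assume e: "e > 0"
    show "\<forall>\<^sub>F q in sequentially. G q \<le> L 0 + e"
      using close[OF e]
    proof eventually_elim
      case (elim q)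
      then show ?case using anti[of 0 "frac (y q)"] frac_ge_0[of "y q"] by linarith
    qed
    \<comment> \<open>Half of e is spent on the continuity of \<open>L\<close>, the other half on
      the distance between \<open>G\<close> and \<open>L (frac (y q))\<close>.\<close>
    have "\<forall>\<^sub>F t in at_right 0. L t > L 0 - e / 2"
      using contL[of 0] e unfolding isCont_def
      by (intro order_tendstoD(1)[of L "L 0"]) (auto intro: tendsto_within_subset)
    then obtain t where t: "t > 0" "\<And>s. 0 < s \<Longrightarrow> s < t \<Longrightarrow> L s > L 0 - e / 2"
      by (auto simp: eventually_at_right[of 0 1])
    have "\<exists>\<^sub>F q in sequentially. 0 < frac (y q) \<and> frac (y q) < min t 1"
      using t by (intro frequently_frac_between y_top y_inc) auto
    then show "\<exists>\<^sub>F q in sequentially. G q \<ge> L 0 - e"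
    proof (rule frequently_rev_mp)
      show "\<forall>\<^sub>F q in sequentially. 0 < frac (y q) \<and> frac (y q) < min t 1 \<longrightarrow> L 0 - e \<le> G q"
        using close[of "e / 2", OF half_gt_zero[OF e]]
      proof eventually_elim
        case (elim q)
        show ?case
        proof
          assume "0 < frac (y q) \<and> frac (y q) < min t 1"
          then have "L (frac (y q)) > L 0 - e / 2" by (intro t(2)) auto
          with elim show "L 0 - e \<le> G q" unfolding abs_less_iff by argo
        qed
      qed
    qed
  qed
  show "liminf (\<lambda>q. ereal (G q)) = ereal (L 1)"
  proof (rule liminf_ereal_eqI)
    fix e :: real assume e: "e > 0"
    show "\<forall>\<^sub>F q in sequentially. G q \<ge> L 1 - e"
      using close[OF e]
    proof eventually_elim
      case (elim q)
      then show ?case using anti[of "frac (y q)" 1] frac_lt_1[of "y q"] by linarith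
    qed
    have "\<forall>\<^sub>F t in at_left 1. L t < L 1 + e / 2"
      using contL[of 1] e unfolding isCont_def
      by (intro order_tendstoD(2)[of L "L 1"]) (auto intro: tendsto_within_subset)
    then obtain t where t: "t < 1" "\<And>s. t < s \<Longrightarrow> s < 1 \<Longrightarrow> L s < L 1 + e / 2"
      by (auto simp: eventually_at_left[of 0 1])
    have "\<exists>\<^sub>F q in sequentially. max t 0 < frac (y q) \<and> frac (y q) < 1"
      using t by (intro frequently_frac_between y_top y_inc) auto
    then show "\<exists>\<^sub>F q in sequentially. G q \<le> L 1 + e"
    proof (rule frequently_rev_mp)
      show "\<forall>\<^sub>F q in sequentially. max t 0 < frac (y q) \<and> frac (y q) < 1 \<longrightarrow> G q \<le> L 1 + e"
        using close[of "e / 2", OF half_gt_zero[OF e]]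
      proof eventually_elim
        case (elim q)
        show ?case
        proof
          assume "max t 0 < frac (y q) \<and> frac (y q) < 1"
          then have "L (frac (y q)) < L 1 + e / 2" by (intro t(2)) auto
          with elim show "G q \<le> L 1 + e" unfolding abs_less_iff by argo
        qed
      qed
    qed
  qed
qed

section \<open>Growth of the centring, inversion of the Gumbel function, and excluding affine
  normalizations\<close>

lemma filterlim_mult_ln_at_top:
  fixes k C :: real
  assumes "k > 0" "C > 0"
  shows "filterlim (\<lambda>q. C * ln (k * real q)) at_top sequentially"
  using assms by real_asymp

lemma mult_ln_Suc_diff_tendsto_0:
  fixes k C :: real
  assumes "k > 0" "C > 0"
  shows "(\<lambda>q. C * ln (k * real (Suc q)) - C * ln (k * real q)) \<longlonglongrightarrow> 0"
  using assms by real_asymp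

text \<open>For p strictly between 0 and 1 neither logarithm in the inverse function meets its
  singularity at 0.\<close>

lemma tendsto_gumbel_cdf_inverse:
  assumes "\<alpha> > 0" "0 < p" "p < 1"
    and "(\<lambda>q. gumbel_cdf (\<alpha> * t q)) \<longlonglongrightarrow> p"
  shows "t \<longlonglongrightarrow> - ln (- ln p) / \<alpha>"
proof -
  have "(\<lambda>q. - ln (- ln (gumbel_cdf (\<alpha> * t q))) / \<alpha>) \<longlonglongrightarrow> - ln (- ln p) / \<alpha>"
    using assms by (intro tendsto_intros) auto
  then show ?thesis
    using assms(1) by (simp add: gumbel_cdf_def)
qed

lemma measurable_Max_nat:
  fixes Y :: "'i \<Rightarrow> 'a \<Rightarrow> nat"
  assumes I: "finite I" "I \<noteq> {}" and Y: "\<And>j. j \<in> I \<Longrightarrow> Y j \<in> M \<rightarrow>\<^sub>M count_space UNIV"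
  shows "(\<lambda>\<omega>. Max ((\<lambda>j. Y j \<omega>) ` I)) \<in> M \<rightarrow>\<^sub>M count_space UNIV"
proof -
  have "(\<lambda>\<omega>. Max ((\<lambda>j. Y j \<omega>) ` I)) -` {k} \<inter> space M =
      (\<Inter>j\<in>I. Y j -` {..k} \<inter> space M) \<inter> (\<Union>j\<in>I. Y j -` {k} \<inter> space M)" for k
  proof -
    have "Max ((\<lambda>j. Y j \<omega>) ` I) = k \<longleftrightarrow> (\<forall>j\<in>I. Y j \<omega> \<le> k) \<and> (\<exists>j\<in>I. Y j \<omega> = k)" for \<omega>
      using I by (subst Max_eq_iff) auto
    then show ?thesis using I by (auto simp: vimage_def)
  qed
  also have "\<dots> k \<in> sets M" for k
    using I by (intro sets.Int sets.finite_INT sets.finite_UN measurable_sets[OF Y]) auto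
  finally show ?thesis
    by (simp add: measurable_count_space_eq2_countable)
qed

text \<open>The approximation is assumed along every integer sequence m, because the sequence to
  which it is applied is dictated by the unknown c and d.\<close>

lemma not_has_nondegenerate_limit_of_gumbel_approx:
  fixes M :: "nat \<Rightarrow> 'w measure" and N :: "nat \<Rightarrow> 'w \<Rightarrow> nat" and b c d :: "nat \<Rightarrow> real"
  assumes \<alpha>: "\<alpha> > 0"
    and b_top: "filterlim b at_top sequentially"
    and b_inc: "(\<lambda>q. b (Suc q) - b q) \<longlonglongrightarrow> 0"
    and N: "\<And>q. q \<ge> 1 \<Longrightarrow> N q \<in> M q \<rightarrow>\<^sub>M count_space UNIV"
    and approx: "\<And>m. (\<lambda>q. measure (M q) {\<omega> \<in> space (M q). int (N q \<omega>) \<le> m q}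
      - gumbel_cdf (\<alpha> * (of_int (m q) - b q))) \<longlonglongrightarrow> 0"
    and c: "\<And>q. q \<ge> 1 \<Longrightarrow> c q > 0"
  shows "\<not> has_nondegenerate_limit M (\<lambda>q \<omega>. (real (N q \<omega>) - d q) / c q)"
proof
  let ?X = "\<lambda>q \<omega>. (real (N q \<omega>) - d q) / c q"
  assume "has_nondegenerate_limit M ?X"
  then obtain \<nu> where \<nu>: "real_distribution \<nu>" "\<not> (\<exists>k. AE x in \<nu>. x = k)"
    and conv: "weak_conv_m (\<lambda>q. distr (M q) borel (?X q)) \<nu>"
    unfolding has_nondegenerate_limit_def by blast
  obtain x where x: "isCont (cdf \<nu>) x" "0 < cdf \<nu> x" "cdf \<nu> x < 1"
    using real_distribution.nondegenerate_continuity_point[OF \<nu>] by blast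
  \<comment> \<open>As N is integer-valued and c is positive, the rescaled variable is at most x
    exactly when N is at most this integer.\<close>
  define m where "m = (\<lambda>q. \<lfloor>d q + c q * x\<rfloor>)"
  have "(\<lambda>q. cdf (distr (M q) borel (?X q)) x) \<longlonglongrightarrow> cdf \<nu> x"
    using conv x(1) unfolding weak_conv_m_def weak_conv_def by blast
  moreover have "\<forall>\<^sub>F q in sequentially. cdf (distr (M q) borel (?X q)) x =
      measure (M q) {\<omega> \<in> space (M q). int (N q \<omega>) \<le> m q}"
    using eventually_ge_at_top[of 1]
  proof eventually_elim
    case (elim q)
    have [measurable]: "N q \<in> M q \<rightarrow>\<^sub>M count_space UNIV" using N elim .
    have "?X q \<omega> \<le> x \<longleftrightarrow> int (N q \<omega>) \<le> m q" for \<omega>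
      using c[OF elim] by (simp add: m_def le_floor_iff divide_le_eq algebra_simps)
    then have "?X q -` {..x} \<inter> space (M q) = {\<omega> \<in> space (M q). int (N q \<omega>) \<le> m q}"
      by auto
    then show ?case
      unfolding cdf_def by (subst measure_distr) auto
  qed
  ultimately have "(\<lambda>q. measure (M q) {\<omega> \<in> space (M q). int (N q \<omega>) \<le> m q}) \<longlonglongrightarrow> cdf \<nu> x"
    by (rule Lim_transform_eventually)
  from tendsto_diff[OF this approx[of m]]
  have "(\<lambda>q. gumbel_cdf (\<alpha> * (of_int (m q) - b q))) \<longlonglongrightarrow> cdf \<nu> x" by simp
  then have "(\<lambda>q. of_int (m q) - b q) \<longlonglongrightarrow> - ln (- ln (cdf \<nu> x)) / \<alpha>"
    by (rule tendsto_gumbel_cdf_inverse[OF \<alpha> x(2,3)])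
  then show False
    using int_diff_creeping_divergent[OF b_top b_inc] by blast
qed

text \<open>The uniform error bound lets the threshold vary with q, as needed for the integer parts
  of d + c x and b + x and for the integers near b.\<close>

lemma gumbel_approx_tendsto_0:
  fixes M :: "nat \<Rightarrow> 'w measure" and Y :: "nat \<Rightarrow> nat \<Rightarrow> 'w \<Rightarrow> nat" and m :: "nat \<Rightarrow> int"
  assumes a: "a \<ge> 2"
    and M: "\<And>q. q \<ge> 1 \<Longrightarrow> prob_space (M q)"
    and indep: "\<And>q. q \<ge> 1 \<Longrightarrow> prob_space.indep_vars (M q) (\<lambda>_. count_space UNIV) (Y q) {1..q}"
    and distr: "\<And>q j. q \<ge> 1 \<Longrightarrow> j \<in> {1..q} \<Longrightarrow> distr (M q) (count_space UNIV) (Y q j) = coupon_law a"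
  defines "\<alpha> \<equiv> ln (real a / (real a - 1))"
  shows "(\<lambda>q. measure (M q) {\<omega> \<in> space (M q). int (Max ((\<lambda>j. Y q j \<omega>) ` {1..q})) \<le> m q}
    - gumbel_cdf (\<alpha> * (of_int (m q) - inverse \<alpha> * ln (real a * real q)))) \<longlonglongrightarrow> 0"
proof (rule Lim_null_comparison)
  have "real a > 0" using a by simp
  then show "(\<lambda>q. 32 / real q + exp (- (real q / 2)) + exp (- (real q / (2 * real a)))) \<longlonglongrightarrow> 0"
    by real_asymp
  show "\<forall>\<^sub>F q in sequentially. norm (measure (M q) {\<omega> \<in> space (M q). int (Max ((\<lambda>j. Y q j \<omega>) ` {1..q})) \<le> m q}
      - gumbel_cdf (\<alpha> * (of_int (m q) - inverse \<alpha> * ln (real a * real q))))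
    \<le> 32 / real q + exp (- (real q / 2)) + exp (- (real q / (2 * real a)))"
    using eventually_ge_at_top[of 1]
  proof eventually_elim
    case (elim q)
    show ?case
      using gumbel_approx[OF a elim M[OF elim] indep[OF elim] distr[OF elim], of "m q"]
      unfolding \<alpha>_def real_norm_def .
  qed
qed

section \<open>Assembly of the three claims\<close>

theorem theorem4p1:
  fixes a :: nat
    and M :: "nat \<Rightarrow> 'w measure"
    and Y :: "nat \<Rightarrow> nat \<Rightarrow> 'w \<Rightarrow> nat"
    and N :: "nat \<Rightarrow> 'w \<Rightarrow> nat"
    and \<alpha> :: real
    and b :: "nat \<Rightarrow> real"
  assumes "a \<ge> 2"
    and "\<And>q. q \<ge> 1 \<Longrightarrow> prob_space (M q)"
    and "\<And>q. q \<ge> 1 \<Longrightarrow> prob_space.indep_vars (M q) (\<lambda>_. count_space UNIV) (Y q) {1..q}"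
    and "\<And>q j. q \<ge> 1 \<Longrightarrow> j \<in> {1..q} \<Longrightarrow>
           distr (M q) (count_space UNIV) (Y q j) = coupon_law a"
  defines "N \<equiv> \<lambda>q \<omega>. Max ((\<lambda>j. Y q j \<omega>) ` {1..q})"
    and "\<alpha> \<equiv> ln (real a / (real a - 1))"
    and "b \<equiv> \<lambda>q. inverse \<alpha> * ln (real a * real q)"
  shows "(\<not> (\<exists>c d :: nat \<Rightarrow> real. (\<forall>q\<ge>1. c q > 0) \<and>
              has_nondegenerate_limit M (\<lambda>q \<omega>. (real (N q \<omega>) - d q) / c q)))
    \<and> (\<forall>x::real.
         ereal (gumbel_cdf (\<alpha> * (x - 1))) =
           liminf (\<lambda>q. ereal (measure (M q) {\<omega> \<in> space (M q). real (N q \<omega>) - b q \<le> x})) \<and>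
         liminf (\<lambda>q. ereal (measure (M q) {\<omega> \<in> space (M q). real (N q \<omega>) - b q \<le> x})) \<le>
           limsup (\<lambda>q. ereal (measure (M q) {\<omega> \<in> space (M q). real (N q \<omega>) - b q \<le> x})) \<and>
         limsup (\<lambda>q. ereal (measure (M q) {\<omega> \<in> space (M q). real (N q \<omega>) - b q \<le> x})) =
           ereal (gumbel_cdf (\<alpha> * x)))
    \<and> (\<forall>n::int.
         (\<lambda>q. measure (M q) {\<omega> \<in> space (M q). int (N q \<omega>) - (\<lfloor>b q\<rfloor> + 1) = n}
              - gumbel_cdf (\<alpha> * (of_int n + 1 - frac (b q)))
              + gumbel_cdf (\<alpha> * (of_int n - frac (b q)))) \<longlonglongrightarrow> 0)"
proof -
  define F where "F = (\<lambda>q (n::int). measure (M q) {\<omega> \<in> space (M q). int (N q \<omega>) \<le> n})"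
  have \<alpha>: "\<alpha> > 0" using assms(1) by (simp add: \<alpha>_def)
  have b_top: "filterlim b at_top sequentially"
    unfolding b_def using assms(1) \<alpha> by (intro filterlim_mult_ln_at_top) auto
  have b_inc: "(\<lambda>q. b (Suc q) - b q) \<longlonglongrightarrow> 0"
    unfolding b_def using assms(1) \<alpha> by (intro mult_ln_Suc_diff_tendsto_0) auto
  have F_seq: "(\<lambda>q. F q (m q) - gumbel_cdf (\<alpha> * (of_int (m q) - b q))) \<longlonglongrightarrow> 0" for m
    unfolding F_def N_def b_def \<alpha>_def by (rule gumbel_approx_tendsto_0[OF assms(1-4)])
  have N_meas: "N q \<in> M q \<rightarrow>\<^sub>M count_space UNIV" if q: "q \<ge> 1" for q
  proof -
    interpret prob_space "M q" using assms(2)[OF q] .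
    show ?thesis
      using assms(3)[OF q] q unfolding N_def indep_vars_def by (intro measurable_Max_nat) auto
  qed

  have bounds: "ereal (gumbel_cdf (\<alpha> * (x - 1))) =
           liminf (\<lambda>q. ereal (measure (M q) {\<omega> \<in> space (M q). real (N q \<omega>) - b q \<le> x})) \<and>
         limsup (\<lambda>q. ereal (measure (M q) {\<omega> \<in> space (M q). real (N q \<omega>) - b q \<le> x})) =
           ereal (gumbel_cdf (\<alpha> * x))" for x
  proof -
    \<comment> \<open>The event is N \<le> floor (b + x), and floor (b + x) - b = x - frac (b + x).
      So the fractional part of the shifted sequence y governs the probability, and \<open>L\<close>
      at 0 and 1 gives the two bounds.\<close>
    define y where "y = (\<lambda>q. b q + x)"
    define L where "L = (\<lambda>t. gumbel_cdf (\<alpha> * (x - t)))"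
    have F_eq: "measure (M q) {\<omega> \<in> space (M q). real (N q \<omega>) - b q \<le> x} = F q \<lfloor>y q\<rfloor>" for q
      unfolding F_def y_def
      by (intro arg_cong[where f = "measure (M q)"]) (auto simp: le_floor_iff algebra_simps)
    have "of_int \<lfloor>y q\<rfloor> - b q = x - frac (y q)" for q
      by (simp add: frac_def y_def)
    then have diff: "(\<lambda>q. F q \<lfloor>y q\<rfloor> - L (frac (y q))) \<longlonglongrightarrow> 0"
      using F_seq[of "\<lambda>q. \<lfloor>y q\<rfloor>"] by (simp add: L_def)
    have y_top: "filterlim y at_top sequentially"
      using filterlim_tendsto_add_at_top[OF tendsto_const b_top, of x] by (simp add: y_def add.commute)
    have y_inc: "(\<lambda>q. y (Suc q) - y q) \<longlonglongrightarrow> 0"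
      using b_inc by (simp add: y_def)
    have anti: "L t \<le> L s" if "s \<le> t" for s t
      using that \<alpha> by (auto simp: L_def intro!: gumbel_cdf_mono)
    have contL: "isCont L t" for t
      unfolding L_def by (rule isCont_o2[OF _ isCont_gumbel_cdf]) (intro continuous_intros)
    show ?thesis
      using limsup_liminf_via_frac[OF y_top y_inc diff anti contL] by (simp add: F_eq L_def)
  qed

  have local: "(\<lambda>q. measure (M q) {\<omega> \<in> space (M q). int (N q \<omega>) - (\<lfloor>b q\<rfloor> + 1) = n}
              - gumbel_cdf (\<alpha> * (of_int n + 1 - frac (b q)))
              + gumbel_cdf (\<alpha> * (of_int n - frac (b q)))) \<longlonglongrightarrow> 0" for n :: int
  proof -
    \<comment> \<open>Under the convention for the ceiling, the event of the local limit is N = k +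
      1, with k - b = n - frac b; hence the increment of \<open>F\<close> from k to k + 1.\<close>
    define k where "k = (\<lambda>q. \<lfloor>b q\<rfloor> + n)"
    have "(\<lambda>q. (F q (k q + 1) - gumbel_cdf (\<alpha> * (of_int (k q + 1) - b q)))
        - (F q (k q) - gumbel_cdf (\<alpha> * (of_int (k q) - b q)))) \<longlonglongrightarrow> 0 - 0"
      by (intro tendsto_diff F_seq)
    then have lim: "(\<lambda>q. (F q (k q + 1) - F q (k q)) - gumbel_cdf (\<alpha> * (of_int (k q + 1) - b q))
        + gumbel_cdf (\<alpha> * (of_int (k q) - b q))) \<longlonglongrightarrow> 0"
      by (simp add: algebra_simps)
    have "\<forall>\<^sub>F q in sequentially. (F q (k q + 1) - F q (k q)) - gumbel_cdf (\<alpha> * (of_int (k q + 1) - b q))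
        + gumbel_cdf (\<alpha> * (of_int (k q) - b q)) =
        measure (M q) {\<omega> \<in> space (M q). int (N q \<omega>) - (\<lfloor>b q\<rfloor> + 1) = n}
        - gumbel_cdf (\<alpha> * (of_int n + 1 - frac (b q)))
        + gumbel_cdf (\<alpha> * (of_int n - frac (b q)))"
      using eventually_ge_at_top[of 1]
    proof eventually_elim
      case (elim q)
      interpret prob_space "M q" using assms(2)[OF elim] .
      have eq: "{\<omega> \<in> space (M q). int (N q \<omega>) \<le> j} = N q -` {i. int i \<le> j} \<inter> space (M q)" for j
        by auto
      have events: "{\<omega> \<in> space (M q). int (N q \<omega>) \<le> j} \<in> events" for j
        unfolding eq by (rule measurable_sets[OF N_meas[OF elim]]) simp
      have "F q (k q + 1) - F q (k q) = measure (M q)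
          ({\<omega> \<in> space (M q). int (N q \<omega>) \<le> k q + 1} - {\<omega> \<in> space (M q). int (N q \<omega>) \<le> k q})"
        unfolding F_def by (subst finite_measure_Diff) (auto simp: events)
      also have "\<dots> = measure (M q) {\<omega> \<in> space (M q). int (N q \<omega>) - (\<lfloor>b q\<rfloor> + 1) = n}"
        by (intro arg_cong[where f = "measure (M q)"]) (auto simp: k_def)
      finally show ?case
        by (simp add: k_def frac_def algebra_simps)
    qed
    from Lim_transform_eventually[OF lim this] show ?thesis .
  qed

  show ?thesis
  proof (intro conjI allI)
    show "\<not> (\<exists>c d. (\<forall>q\<ge>1. c q > 0) \<and>
        has_nondegenerate_limit M (\<lambda>q \<omega>. (real (N q \<omega>) - d q) / c q))"
      using not_has_nondegenerate_limit_of_gumbel_approx[OF \<alpha> b_top b_inc N_meas F_seq[unfolded F_def]]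
      by auto
  qed (rule bounds[THEN conjunct1] Liminf_le_Limsup[OF sequentially_bot] bounds[THEN conjunct2] local)+
qed

end
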